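(* Let $\mathfrak X=(X,\sim)$ be a cdGES. (a) Each partial morphism of $\mathfrak X$ is a continuous function and extends to a partial morphism defined on a closed set. (b) For any closed set $Z\subset X$ the set $\mathrm{Mor}(Z,X)$ of all partial morphisms $f\colon Z\to X$ of $\mathfrak X$ is compact in the compact-open topology of the space $C(Z,X)$ of all continuous functions from $Z$ into $X$. (c) Each morphism of $\mathfrak X$ is an automorphism. (d) The group $\mathrm{Aut}(\mathfrak X)$ of all automorphisms of $\mathfrak X$ is a compact topological group in the compact-open topology. (e) Let $D$ be a fixed dense subset of $X$. $\mathfrak X$ is absolutely homogeneous iff every partial morphism defined on a finite subset $A$ of $X$ extends to a partial morphism defined on $A\cup\{a\}$ for each $a\in D$.
   Context: An edge similarity on a set $V$ is an equivalence relation $\sim$ on the set $V\times V$ such that for all $x,y,z\in V$: $(x,y)\sim(z,z)\iff x=y$. A dGES (directed graph with edge similarity) is a set equipped with an edge similarity. A partial morphism of a dGES $(V,\sim)$ is a function $f\colon A\to V$ defined on a subset $A\subset V$ such that $(f(x),f(y))\sim(x,y)$ for all $x,y\in A$ (such $f$ is one-to-one). If $A=V$, it is called a morphism; a bijective morphism is called an automorphism. A dGES is absolutely homogeneous if every its partial morphism extends to an automorphism. A cdGES (compact dGES) is a compact Hausdorff topological space $X$ equipped with an edge similarity $\sim$ that is closed as a subset of $(X\times X)\times(X\times X)$. No continuity is assumed a priori of partial morphisms. *)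

theory Defs
  imports "HOL-Analysis.Analysis" "HOL-Algebra.Bij"
begin

definition edge_similarity :: "'a set \<Rightarrow> (('a \<times> 'a) \<times> ('a \<times> 'a)) set \<Rightarrow> bool" where
  "edge_similarity V E \<longleftrightarrow>
     equiv (V \<times> V) E \<and>
     (\<forall>x\<in>V. \<forall>y\<in>V. \<forall>z\<in>V. ((x, y), (z, z)) \<in> E \<longleftrightarrow> x = y)"

text \<open>The values of \<open>f\<close> outside its domain \<open>A\<close> are irrelevant here; where functions are collected
  into a set, they are normalised to be \<^const>\<open>extensional\<close>.\<close>

definition partial_morphism ::
  "'a set \<Rightarrow> (('a \<times> 'a) \<times> ('a \<times> 'a)) set \<Rightarrow> 'a set \<Rightarrow> ('a \<Rightarrow> 'a) \<Rightarrow> bool" where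
  "partial_morphism V E A f \<longleftrightarrow>
     A \<subseteq> V \<and> f \<in> A \<rightarrow> V \<and> (\<forall>x\<in>A. \<forall>y\<in>A. ((f x, f y), (x, y)) \<in> E)"

definition morphism :: "'a set \<Rightarrow> (('a \<times> 'a) \<times> ('a \<times> 'a)) set \<Rightarrow> ('a \<Rightarrow> 'a) \<Rightarrow> bool" where
  "morphism V E f \<longleftrightarrow> partial_morphism V E V f"

definition automorphism :: "'a set \<Rightarrow> (('a \<times> 'a) \<times> ('a \<times> 'a)) set \<Rightarrow> ('a \<Rightarrow> 'a) \<Rightarrow> bool" where
  "automorphism V E f \<longleftrightarrow> morphism V E f \<and> bij_betw f V V"

definition absolutely_homogeneous :: "'a set \<Rightarrow> (('a \<times> 'a) \<times> ('a \<times> 'a)) set \<Rightarrow> bool" where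
  "absolutely_homogeneous V E \<longleftrightarrow>
     (\<forall>A f. partial_morphism V E A f \<longrightarrow>
        (\<exists>g. automorphism V E g \<and> (\<forall>x\<in>A. g x = f x)))"

definition cdGES :: "'a topology \<Rightarrow> (('a \<times> 'a) \<times> ('a \<times> 'a)) set \<Rightarrow> bool" where
  "cdGES X E \<longleftrightarrow>
     compact_space X \<and> Hausdorff_space X \<and>
     edge_similarity (topspace X) E \<and>
     closedin (prod_topology (prod_topology X X) (prod_topology X X)) E"

definition continuous_maps :: "'a topology \<Rightarrow> 'b topology \<Rightarrow> ('a \<Rightarrow> 'b) set" where
  "continuous_maps S T = {f \<in> extensional (topspace S). continuous_map S T f}"

text \<open>Taking \<open>K = {}\<close> shows that the underlying set of this topology is all of
  \<^term>\<open>continuous_maps S T\<close>.\<close>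

definition compact_open_topology :: "'a topology \<Rightarrow> 'b topology \<Rightarrow> ('a \<Rightarrow> 'b) topology" where
  "compact_open_topology S T =
     topology_generated_by
       {{f \<in> continuous_maps S T. f ` K \<subseteq> U} | K U. compactin S K \<and> openin T U}"

lemma topspace_compact_open_topology:
  "topspace (compact_open_topology S T) = continuous_maps S T"
proof -
  have "continuous_maps S T \<in>
      {{f \<in> continuous_maps S T. f ` K \<subseteq> U} | K U. compactin S K \<and> openin T U}"
    by (intro CollectI exI[of _ "{}"]) auto
  then show ?thesis
    unfolding compact_open_topology_def topology_generated_by_topspace by blast
qed

definition Mor :: "'a set \<Rightarrow> (('a \<times> 'a) \<times> ('a \<times> 'a)) set \<Rightarrow> 'a set \<Rightarrow> ('a \<Rightarrow> 'a) set" where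
  "Mor V E Z = {f \<in> extensional Z. partial_morphism V E Z f}"

definition Aut :: "'a set \<Rightarrow> (('a \<times> 'a) \<times> ('a \<times> 'a)) set \<Rightarrow> ('a \<Rightarrow> 'a) set" where
  "Aut V E = {f \<in> extensional V. automorphism V E f}"

text \<open>The operation is composition, inherited from \<^const>\<open>BijGroup\<close>.\<close>

definition AutGroup :: "'a set \<Rightarrow> (('a \<times> 'a) \<times> ('a \<times> 'a)) set \<Rightarrow> ('a \<Rightarrow> 'a) monoid" where
  "AutGroup V E = BijGroup V \<lparr>carrier := Aut V E\<rparr>"

text \<open>No separation axiom is included.\<close>

definition topological_group :: "('g, 'm) monoid_scheme \<Rightarrow> 'g topology \<Rightarrow> bool" where
  "topological_group G T \<longleftrightarrow>
     group G \<and> topspace T = carrier G \<and>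
     continuous_map (prod_topology T T) T (\<lambda>(g, h). g \<otimes>\<^bsub>G\<^esub> h) \<and>
     continuous_map T T (\<lambda>g. inv\<^bsub>G\<^esub> g)"

end

theory Submission
  imports Defs
begin

text \<open>
  Everything rests on one observation: since \<open>(u, v) \<sim> (x, x)\<close> forces \<open>u = v\<close>, the value \<open>y = f x\<close>
  of a partial morphism \<open>f\<close> on \<open>Z\<close> is characterised by the conditions \<open>(f a, y) \<sim> (a, x)\<close> for all
  \<open>a \<in> Z\<close>. These are closed conditions on the triple \<open>(f, x, y)\<close>, even when \<open>f\<close> varies in the
  topology of pointwise convergence. As \<open>X\<close> is compact, a map into \<open>X\<close> with a closed graph is
  continuous, so evaluation \<open>(f, x) \<mapsto> f x\<close> is jointly continuous on \<open>Mor(Z, X) \<times> Z\<close>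
  (\<open>joint_evaluation_continuous\<close>). Hence a single partial morphism is continuous, and the compact-open
  topology on \<open>Mor(Z, X)\<close> is the topology of pointwise convergence (\<open>compact_open_eq_pointwise\<close>).
  In the latter, \<open>Mor(Z, X)\<close> is a closed subset of the power \<open>X\<^sup>Z\<close>, so it is compact by Tychonoff's
  theorem.

  The extension in (a) is the closure of the graph of the partial morphism: the relation
  \<open>(u, v) \<sim> (x, y)\<close> between points \<open>(x, u)\<close>, \<open>(y, v)\<close> of the graph persists in the closure, which is
  therefore again the graph of a partial morphism, and its domain is the projection of a compact set.

  For (c), suppose that \<open>x\<close> is outside the compact image of a morphism \<open>f\<close>. Then
  \<open>(f\<^sup>n x, f\<^sup>m x) \<sim> (f\<^sup>n\<^sup>-\<^sup>m x, x)\<close> for \<open>m < n\<close> keeps \<open>(f\<^sup>n x, f\<^sup>m x)\<close> outside a fixed neighbourhood of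
  the diagonal, so the orbit of \<open>x\<close> is an infinite uniformly discrete set in a compact space.

  By (c) the automorphisms are exactly the total morphisms, so (b) gives the compactness in (d).
  Composition is continuous by joint evaluation, and inversion because \<open>y = g\<^sup>-\<^sup>1 a\<close> says \<open>g y = a\<close>, which
  is a closed condition on \<open>(g, y)\<close>. For (e), one-point extensions yield extensions to finite sets,
  compactness of \<open>X\<^sup>X\<close> glues these to an extension to \<open>A \<union> D\<close>, (a) extends it to the closure, which
  is \<open>X\<close>, and (c) makes it an automorphism.
\<close>

section \<open>Closed sets and closed graphs\<close>

lemma closedin_Collect_ball:
  assumes "\<And>i. i \<in> I \<Longrightarrow> closedin T {z \<in> topspace T. P i z}"
  shows "closedin T {z \<in> topspace T. \<forall>i\<in>I. P i z}"
proof -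
  have "{z \<in> topspace T. \<forall>i\<in>I. P i z} =
      \<Inter>(insert (topspace T) ((\<lambda>i. {z \<in> topspace T. P i z}) ` I))"
    by auto
  moreover have "closedin T \<dots>"
    using assms by (intro closedin_Inter) auto
  ultimately show ?thesis by simp
qed

text \<open>The preimage of a closed set \<open>C\<close> is the projection of the closed part of the graph over \<open>C\<close>,
  and projecting along a compact factor is a closed map.\<close>

lemma continuous_map_if_closed_graph:
  assumes "compact_space Y" and f: "f \<in> topspace X \<rightarrow> topspace Y"
    and graph: "closedin (prod_topology X Y) ((\<lambda>x. (x, f x)) ` topspace X)"
  shows "continuous_map X Y f"
  unfolding continuous_map_closedin
proof (intro conjI allI impI)
  show "f \<in> topspace X \<rightarrow> topspace Y" by fact
next
  fix C assume C: "closedin Y C"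
  have "{x \<in> topspace X. f x \<in> C} =
      fst ` ((\<lambda>x. (x, f x)) ` topspace X \<inter> topspace X \<times> C)"
    by force
  moreover have "closedin (prod_topology X Y) ((\<lambda>x. (x, f x)) ` topspace X \<inter> topspace X \<times> C)"
    using C graph by (intro closedin_Int) (auto simp: closedin_prod_Times_iff)
  ultimately show "closedin X {x \<in> topspace X. f x \<in> C}"
    using closed_map_fst[OF \<open>compact_space Y\<close>, of X] unfolding closed_map_def by simp
qed

section \<open>Compact edge similarities\<close>

locale compact_dGES =
  fixes X :: "'a topology" and E :: "(('a \<times> 'a) \<times> ('a \<times> 'a)) set"
  assumes cdGES: "cdGES X E"
begin

abbreviation V where "V \<equiv> topspace X"

lemma compact_X: "compact_space X"
  and Hausdorff_X: "Hausdorff_space X"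
  and closed_E: "closedin (prod_topology (prod_topology X X) (prod_topology X X)) E"
  using cdGES by (auto simp: cdGES_def)

lemma equiv_E: "equiv (V \<times> V) E"
  using cdGES by (auto simp: cdGES_def edge_similarity_def)

lemma E_sym: "(p, q) \<in> E \<Longrightarrow> (q, p) \<in> E"
  using equiv_E by (meson equivE symE)

lemma E_trans: "(p, q) \<in> E \<Longrightarrow> (q, r) \<in> E \<Longrightarrow> (p, r) \<in> E"
  using equiv_E by (meson equivE transE)

lemma E_refl: "x \<in> V \<Longrightarrow> y \<in> V \<Longrightarrow> ((x, y), (x, y)) \<in> E"
  using equiv_E by (auto elim!: equivE simp: refl_on_def)

lemma E_in_V: "((x, y), (z, w)) \<in> E \<Longrightarrow> x \<in> V \<and> y \<in> V \<and> z \<in> V \<and> w \<in> V"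
  using equiv_E by (auto elim!: equivE)

lemma E_diagonal: "((x, y), (z, z)) \<in> E \<Longrightarrow> x = y"
  using cdGES E_in_V[of x y z z] by (auto simp: cdGES_def edge_similarity_def)

lemma closedin_E_preimage:
  assumes "continuous_map T X a" "continuous_map T X b" "continuous_map T X c" "continuous_map T X d"
  shows "closedin T {z \<in> topspace T. ((a z, b z), (c z, d z)) \<in> E}"
  using closedin_continuous_map_preimage[OF _ closed_E, of T "\<lambda>z. ((a z, b z), (c z, d z))"] assms
  by (simp add: continuous_map_paired)

lemma partial_morphism_inj_on: "partial_morphism V E A f \<Longrightarrow> inj_on f A"
  by (metis E_diagonal E_sym inj_onI partial_morphism_def)

section \<open>Extending a partial morphism to a closed set\<close>

text \<open>The extension is read off from the closure of the graph of \<open>f\<close> in \<open>X \<times> X\<close>, which is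
  single-valued because the similarity is closed; its domain is closed as a projection along \<open>X\<close>.\<close>

lemma partial_morphism_extends_to_closed_set:
  assumes f: "partial_morphism V E A f"
  obtains B g where "closedin X B" "A \<subseteq> B" "partial_morphism V E B g" "\<forall>x\<in>A. g x = f x"
proof -
  let ?P = "prod_topology X X" and ?G = "(\<lambda>x. (x, f x)) ` A"
  define \<Gamma> where "\<Gamma> = ?P closure_of ?G"
  have AV: "A \<subseteq> V" and fV: "f \<in> A \<rightarrow> V" and fE: "\<And>x y. x \<in> A \<Longrightarrow> y \<in> A \<Longrightarrow> ((f x, f y), (x, y)) \<in> E"
    using f by (auto simp: partial_morphism_def)
  \<comment> \<open>A pair of points of \<open>\<Gamma>\<close> is a limit of pairs of points of the graph, and the similarity is closed.\<close>
  have \<Gamma>E: "((u, v), (x, y)) \<in> E" if "(x, u) \<in> \<Gamma>" "(y, v) \<in> \<Gamma>" for x u y v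
  proof -
    have "((x, u), (y, v)) \<in> prod_topology ?P ?P closure_of (?G \<times> ?G)"
      using that by (simp add: closure_of_Times \<Gamma>_def)
    then have "case ((x, u), (y, v)) of ((x, u), (y, v)) \<Rightarrow> ((u, v), (x, y)) \<in> E"
    proof (rule forall_in_closure_of)
      show "case p of ((x, u), (y, v)) \<Rightarrow> ((u, v), (x, y)) \<in> E" if "p \<in> ?G \<times> ?G" for p
        using that fE by auto
      have "closedin (prod_topology ?P ?P) {p \<in> topspace (prod_topology ?P ?P).
          ((snd (fst p), snd (snd p)), (fst (fst p), fst (snd p))) \<in> E}"
        by (intro closedin_E_preimage continuous_map_fst_of[unfolded o_def]
            continuous_map_snd_of[unfolded o_def]; rule continuous_map_id[unfolded id_def])
      then show "closedin (prod_topology ?P ?P) {p \<in> topspace (prod_topology ?P ?P).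
          case p of ((x, u), (y, v)) \<Rightarrow> ((u, v), (x, y)) \<in> E}"
        by (simp add: case_prod_unfold)
    qed
    then show ?thesis by simp
  qed
  have G: "?G \<subseteq> \<Gamma>"
    unfolding \<Gamma>_def using AV fV by (intro closure_of_subset) auto
  have \<Gamma>_closed: "closedin ?P \<Gamma>" by (simp add: \<Gamma>_def)
  define g where "g x = (SOME u. (x, u) \<in> \<Gamma>)" for x
  have g: "(x, g x) \<in> \<Gamma>" if "x \<in> fst ` \<Gamma>" for x
  proof -
    have "\<exists>u. (x, u) \<in> \<Gamma>" using that by auto
    then show ?thesis unfolding g_def by (rule someI_ex)
  qed
  show thesis
  proof
    show "closedin X (fst ` \<Gamma>)"
      using closed_map_fst[OF compact_X] \<Gamma>_closed by (auto simp: closed_map_def)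
    show "A \<subseteq> fst ` \<Gamma>" using G by force
    show "partial_morphism V E (fst ` \<Gamma>) g"
      unfolding partial_morphism_def
    proof (intro conjI ballI)
      have \<Gamma>V: "\<Gamma> \<subseteq> V \<times> V" using closedin_subset[OF \<Gamma>_closed] by simp
      then show "fst ` \<Gamma> \<subseteq> V" by auto
      show "g \<in> fst ` \<Gamma> \<rightarrow> V" using \<Gamma>V g by blast
      show "((g x, g y), (x, y)) \<in> E" if "x \<in> fst ` \<Gamma>" "y \<in> fst ` \<Gamma>" for x y
        by (rule \<Gamma>E[OF g[OF that(1)] g[OF that(2)]])
    qed
    show "\<forall>x\<in>A. g x = f x"
    proof
      fix x assume "x \<in> A"
      then have "(x, f x) \<in> \<Gamma>" using G by blast
      moreover from this have "(x, g x) \<in> \<Gamma>" using g by force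
      ultimately show "g x = f x" using \<Gamma>E E_diagonal by blast
    qed
  qed
qed

section \<open>The pointwise topology on partial morphisms\<close>

text \<open>This topology serves as a tractable description of the compact-open topology, with which it is
  shown to agree below; compactness and continuity into it can be checked coordinatewise.\<close>

definition pointwise where
  "pointwise Z = subtopology (product_topology (\<lambda>_. X) Z) (Mor V E Z)"

lemma Mor_iff:
  assumes "Z \<subseteq> V"
  shows "f \<in> Mor V E Z \<longleftrightarrow> f \<in> (\<Pi>\<^sub>E x\<in>Z. V) \<and> (\<forall>x\<in>Z. \<forall>y\<in>Z. ((f x, f y), (x, y)) \<in> E)"
  using assms by (auto simp: Mor_def partial_morphism_def PiE_def)

lemma topspace_pointwise: "Z \<subseteq> V \<Longrightarrow> topspace (pointwise Z) = Mor V E Z"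
  by (auto simp: pointwise_def Mor_iff)

lemma restrict_in_Mor: "partial_morphism V E A f \<Longrightarrow> restrict f A \<in> Mor V E A"
  by (auto simp: Mor_def partial_morphism_def)

lemma continuous_map_product_eval:
  assumes "continuous_map T (product_topology (\<lambda>_. X) Z) F" "a \<in> Z"
  shows "continuous_map T X (\<lambda>t. F t a)"
  using continuous_map_compose[OF assms(1) continuous_map_product_projection[OF assms(2)]]
  by (simp add: o_def)

lemma continuous_map_pointwise_eval:
  assumes "continuous_map T (pointwise Z) F" "a \<in> Z"
  shows "continuous_map T X (\<lambda>t. F t a)"
  using assms by (intro continuous_map_product_eval)
    (auto simp: pointwise_def continuous_map_in_subtopology)

lemma continuous_map_into_pointwise:
  assumes "F \<in> topspace T \<rightarrow> Mor V E Z" "\<And>a. a \<in> Z \<Longrightarrow> continuous_map T X (\<lambda>t. F t a)"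
  shows "continuous_map T (pointwise Z) F"
  using assms by (auto simp: pointwise_def continuous_map_in_subtopology
      continuous_map_componentwise Mor_def)

lemma closedin_partial_morphism:
  assumes "F \<subseteq> Z" "Z \<subseteq> V"
  shows "closedin (product_topology (\<lambda>_. X) Z)
    {f \<in> topspace (product_topology (\<lambda>_. X) Z). \<forall>x\<in>F. \<forall>y\<in>F. ((f x, f y), (x, y)) \<in> E}"
  using assms by (intro closedin_Collect_ball closedin_E_preimage continuous_map_product_projection) auto

lemma compact_product: "compact_space (product_topology (\<lambda>_. X) Z)"
  by (simp add: compact_space_product_topology compact_X)

text \<open>Being a partial morphism is an intersection of closed conditions on pairs of coordinates, so
  Tychonoff's theorem applies.\<close>

lemma compact_pointwise:
  assumes "Z \<subseteq> V"
  shows "compact_space (pointwise Z)"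
proof -
  have "Mor V E Z = {f \<in> topspace (product_topology (\<lambda>_. X) Z). \<forall>x\<in>Z. \<forall>y\<in>Z. ((f x, f y), (x, y)) \<in> E}"
    using Mor_iff[OF assms] by auto
  then show ?thesis
    unfolding pointwise_def using assms closedin_partial_morphism[of Z Z]
    by (metis closedin_compact_space compact_product compact_space_subtopology order_refl)
qed

lemma Hausdorff_pointwise: "Hausdorff_space (pointwise Z)"
  unfolding pointwise_def
  by (intro Hausdorff_space_subtopology) (simp add: Hausdorff_space_product_topology Hausdorff_X)

text \<open>This replaces an equicontinuity argument. The graph of evaluation is the set of those
  \<open>((f, x), y)\<close> with \<open>(f a, y) \<sim> (a, x)\<close> for every \<open>a \<in> Z\<close>; taking \<open>a = x\<close> gives \<open>y = f x\<close>.\<close>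

lemma joint_evaluation_continuous:
  assumes Z: "Z \<subseteq> V"
  shows "continuous_map (prod_topology (pointwise Z) (subtopology X Z)) X (\<lambda>(f, x). f x)"
proof -
  let ?S = "prod_topology (pointwise Z) (subtopology X Z)"
  have top: "topspace ?S = Mor V E Z \<times> Z"
    using Z by (auto simp: topspace_pointwise)
  have graph: "(\<lambda>p. (p, case p of (f, x) \<Rightarrow> f x)) ` topspace ?S =
    {w \<in> topspace (prod_topology ?S X). \<forall>a\<in>Z. ((fst (fst w) a, snd w), (a, snd (fst w))) \<in> E}"
    (is "?L = ?R")
  proof
    show "?L \<subseteq> ?R"
      unfolding topspace_prod_topology[of ?S X] top using Z by (auto simp: Mor_iff)
    show "?R \<subseteq> ?L"
    proof
      fix w assume w: "w \<in> ?R"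
      obtain f x y where [simp]: "w = ((f, x), y)" by (metis prod.collapse)
      from w have fx: "f \<in> Mor V E Z" "x \<in> Z" unfolding topspace_prod_topology[of ?S X] top by auto
      with w have "((f x, y), (x, x)) \<in> E" by auto
      then have "y = f x" using E_diagonal by blast
      then show "w \<in> ?L" unfolding top using fx by auto
    qed
  qed
  have fst': "continuous_map (prod_topology ?S X) (pointwise Z) (\<lambda>w. fst (fst w))"
    and snd': "continuous_map (prod_topology ?S X) (subtopology X Z) (\<lambda>w. snd (fst w))"
    by (intro continuous_map_fst_of[unfolded o_def] continuous_map_snd_of[unfolded o_def]; rule continuous_map_id[unfolded id_def])+
  have "closedin (prod_topology ?S X) ?R"
    using Z by (intro closedin_Collect_ball closedin_E_preimage continuous_map_pointwise_eval[OF fst']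
        continuous_map_snd continuous_map_into_fulltopology[OF snd']) auto
  then have "closedin (prod_topology ?S X) ((\<lambda>p. (p, case p of (f, x) \<Rightarrow> f x)) ` topspace ?S)"
    unfolding graph .
  moreover have "(\<lambda>(f, x). f x) \<in> topspace ?S \<rightarrow> V"
    unfolding top using Z by (auto simp: Mor_iff)
  ultimately show ?thesis
    by (intro continuous_map_if_closed_graph[OF compact_X])
qed

lemma partial_morphism_continuous:
  assumes f: "partial_morphism V E A f"
  shows "continuous_map (subtopology X A) X f"
proof -
  have A: "A \<subseteq> V" using f by (simp add: partial_morphism_def)
  have "continuous_map (subtopology X A) (prod_topology (pointwise A) (subtopology X A)) (\<lambda>x. (restrict f A, x))"
    using restrict_in_Mor[OF f] topspace_pointwise[OF A]
    by (simp add: continuous_map_paired)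
  from continuous_map_compose[OF this joint_evaluation_continuous[OF A]]
  show ?thesis
    by (rule continuous_map_eq) (use A in auto)
qed

section \<open>The compact-open topology\<close>

lemma Mor_subset_continuous_maps:
  assumes "Z \<subseteq> V"
  shows "Mor V E Z \<subseteq> continuous_maps (subtopology X Z) X"
  using assms partial_morphism_continuous
  by (auto simp: Mor_def continuous_maps_def Int_absorb1)

text \<open>Singletons are compact, so the compact-open topology is always at least as fine. Conversely, by
  joint continuity of evaluation, the \<open>f\<close> that map some point of a compact set \<open>K\<close> outside an open
  set \<open>U\<close> form the projection along \<open>K\<close> of a closed set, hence a closed set.\<close>

lemma compact_open_eq_pointwise:
  assumes Z: "Z \<subseteq> V"
  shows "subtopology (compact_open_topology (subtopology X Z) X) (Mor V E Z) = pointwise Z"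
    (is "subtopology ?C ?M = _")
proof -
  have top: "topspace (subtopology ?C ?M) = ?M"
    using Mor_subset_continuous_maps[OF Z] by (auto simp: topspace_compact_open_topology)
  have "continuous_map (subtopology ?C ?M) (pointwise Z) id"
  proof (intro continuous_map_into_pointwise)
    show "id \<in> topspace (subtopology ?C ?M) \<rightarrow> ?M" by (simp add: top)
  next
    fix a assume a: "a \<in> Z"
    show "continuous_map (subtopology ?C ?M) X (\<lambda>f. id f a)"
      unfolding continuous_map_def top
    proof (intro conjI allI impI)
      show "(\<lambda>f. id f a) \<in> ?M \<rightarrow> V" using a Z by (auto simp: Mor_iff)
    next
      fix U assume U: "openin X U"
      have "compactin (subtopology X Z) {a}" using a Z by (auto simp: compactin_subtopology)
      then have "openin ?C {f \<in> continuous_maps (subtopology X Z) X. f ` {a} \<subseteq> U}"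
        unfolding compact_open_topology_def using U by (intro topology_generated_by_Basis) blast
      moreover have "{f \<in> ?M. id f a \<in> U} = {f \<in> continuous_maps (subtopology X Z) X. f ` {a} \<subseteq> U} \<inter> ?M"
        using Mor_subset_continuous_maps[OF Z] by auto
      ultimately show "openin (subtopology ?C ?M) {f \<in> ?M. id f a \<in> U}"
        by (auto simp: openin_subtopology)
    qed
  qed
  moreover have "continuous_map (pointwise Z) (subtopology ?C ?M) id"
  proof -
    have "continuous_map (pointwise Z) ?C id"
      unfolding compact_open_topology_def
    proof (rule continuous_on_generated_topo)
      have "\<Union>{{f \<in> continuous_maps (subtopology X Z) X. f ` K \<subseteq> U} |K U. compactin (subtopology X Z) K \<and> openin X U}
          = topspace ?C"
        unfolding compact_open_topology_def topology_generated_by_topspace ..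
      then show "id ` topspace (pointwise Z) \<subseteq>
        \<Union>{{f \<in> continuous_maps (subtopology X Z) X. f ` K \<subseteq> U} |K U. compactin (subtopology X Z) K \<and> openin X U}"
        using Mor_subset_continuous_maps[OF Z] topspace_pointwise[OF Z] by (simp add: topspace_compact_open_topology)
    next
      fix W assume "W \<in> {{f \<in> continuous_maps (subtopology X Z) X. f ` K \<subseteq> U} |K U. compactin (subtopology X Z) K \<and> openin X U}"
      then obtain K U where W: "W = {f \<in> continuous_maps (subtopology X Z) X. f ` K \<subseteq> U}"
        and K: "compactin (subtopology X Z) K" and U: "openin X U" by auto
      have KZ: "K \<subseteq> Z" and KX: "compactin X K" using K by (auto simp: compactin_subtopology)
      let ?S = "prod_topology (pointwise Z) (subtopology X K)"
      have topS: "topspace ?S = ?M \<times> K"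
        using topspace_pointwise[OF Z] KZ Z by auto
      have "continuous_map ?S (subtopology X Z) snd"
        using continuous_map_into_fulltopology[OF continuous_map_snd] KZ
        by (auto simp: continuous_map_in_subtopology)
      then have "continuous_map ?S (prod_topology (pointwise Z) (subtopology X Z)) id"
        by (simp add: continuous_map_pairwise continuous_map_fst)
      from continuous_map_compose[OF this joint_evaluation_continuous[OF Z]]
      have "continuous_map ?S X (\<lambda>(f, x). f x)" by simp
      then have "closedin ?S {p \<in> topspace ?S. (case p of (f, x) \<Rightarrow> f x) \<in> V - U}"
        using U by (intro closedin_continuous_map_preimage) auto
      then have "closedin (pointwise Z) (fst ` {p \<in> topspace ?S. (case p of (f, x) \<Rightarrow> f x) \<in> V - U})"
        using closed_map_fst[OF compact_space_subtopology[OF KX], of "pointwise Z"]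
        unfolding closed_map_def by blast
      then have "openin (pointwise Z) (topspace (pointwise Z) -
          fst ` {p \<in> topspace ?S. (case p of (f, x) \<Rightarrow> f x) \<in> V - U})" by blast
      moreover have "topspace (pointwise Z) - fst ` {p \<in> topspace ?S. (case p of (f, x) \<Rightarrow> f x) \<in> V - U}
          = id -` W \<inter> topspace (pointwise Z)" (is "?L = ?R")
      proof
        show "?L \<subseteq> ?R"
        proof
          fix f assume f: "f \<in> ?L"
          then have fM: "f \<in> ?M" using topspace_pointwise[OF Z] by auto
          have "f x \<in> U" if x: "x \<in> K" for x
          proof (rule ccontr)
            assume "f x \<notin> U"
            moreover have "f x \<in> V" using fM x KZ Z by (auto simp: Mor_iff)
            ultimately have "(f, x) \<in> {p \<in> topspace ?S. (case p of (f, x) \<Rightarrow> f x) \<in> V - U}"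
              unfolding topS using fM x by simp
            then have "f \<in> fst ` {p \<in> topspace ?S. (case p of (f, x) \<Rightarrow> f x) \<in> V - U}"
              by (rule rev_image_eqI) simp
            with f show False by blast
          qed
          then show "f \<in> ?R"
            unfolding W using f fM Mor_subset_continuous_maps[OF Z] by auto
        qed
        show "?R \<subseteq> ?L"
          unfolding topS topspace_pointwise[OF Z] W by auto
      qed
      ultimately show "openin (pointwise Z) (id -` W \<inter> topspace (pointwise Z))" by simp
    qed
    then show ?thesis
      using topspace_pointwise[OF Z] by (simp add: continuous_map_in_subtopology)
  qed
  ultimately show ?thesis
    unfolding topology_eq using topspace_pointwise[OF Z] top topology_finer_continuous_id by metis
qed

lemma compactin_Mor:
  assumes "Z \<subseteq> V"
  shows "compactin (compact_open_topology (subtopology X Z) X) (Mor V E Z)"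
  using compact_pointwise[OF assms] Mor_subset_continuous_maps[OF assms]
  by (simp add: compactin_subspace compact_open_eq_pointwise[OF assms] topspace_compact_open_topology)

section \<open>Morphisms are automorphisms\<close>

text \<open>If \<open>x\<close> were not in the image, the orbit of \<open>x\<close> would be uniformly discrete: each pair of a later and an
  earlier iterate lies in the closed set \<open>S\<close> of pairs similar to some \<open>(y, x)\<close> with \<open>y\<close> in the image, which misses the
  diagonal. The pigeonhole principle for a finite cover by sets whose squares miss \<open>S\<close> refutes this.\<close>

lemma morphism_surj:
  assumes f: "morphism V E f"
  shows "V \<subseteq> f ` V"
proof
  fix x assume x: "x \<in> V"
  have fV: "f \<in> V \<rightarrow> V" and fE: "\<And>x y. x \<in> V \<Longrightarrow> y \<in> V \<Longrightarrow> ((f x, f y), (x, y)) \<in> E"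
    using f by (auto simp: morphism_def partial_morphism_def)
  have "continuous_map X X f"
    using partial_morphism_continuous f by (metis morphism_def subtopology_topspace)
  then have "compactin X (f ` V)"
    using compact_X image_compactin unfolding compact_space_def by blast
  then have closed_image: "closedin X (f ` V)"
    by (rule compactin_imp_closedin[OF Hausdorff_X])
  let ?P = "prod_topology X X"
  define S where "S = {(u, v). \<exists>y\<in>f ` V. ((u, v), (y, x)) \<in> E}"
  have S_closed: "closedin ?P S"
  proof -
    let ?Q = "prod_topology ?P X"
    \<comment> \<open>The witness \<open>y\<close> ranges over the compact space \<open>X\<close> and can be projected away.\<close>
    have "S = fst ` ({w \<in> topspace ?Q. ((fst (fst w), snd (fst w)), (snd w, x)) \<in> E}
        \<inter> topspace ?P \<times> f ` V)" (is "S = fst ` ?T")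
    proof
      show "S \<subseteq> fst ` ?T"
      proof
        fix p assume "p \<in> S"
        then obtain u v y where p: "p = (u, v)" "y \<in> f ` V" "((u, v), (y, x)) \<in> E"
          unfolding S_def by blast
        then have "((u, v), y) \<in> ?T" using E_in_V[OF p(3)] by simp
        then show "p \<in> fst ` ?T" unfolding p(1) by (rule rev_image_eqI) simp
      qed
      show "fst ` ?T \<subseteq> S" unfolding S_def by auto
    qed
    moreover have "closedin ?Q ({w \<in> topspace ?Q. ((fst (fst w), snd (fst w)), (snd w, x)) \<in> E}
        \<inter> topspace ?P \<times> f ` V)"
    proof (intro closedin_Int closedin_E_preimage)
      show "closedin ?Q (topspace ?P \<times> f ` V)"
        using closed_image closedin_topspace by (auto simp: closedin_prod_Times_iff simp del: topspace_prod_topology)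
      show "continuous_map ?Q X (\<lambda>w. fst (fst w))" "continuous_map ?Q X (\<lambda>w. snd (fst w))"
        by (rule continuous_map_fst_of[unfolded o_def] continuous_map_snd_of[unfolded o_def], rule continuous_map_fst)+
    qed (use x in \<open>simp_all add: continuous_map_snd\<close>)
    ultimately show ?thesis
      using closed_map_fst[OF compact_X, of ?P] unfolding closed_map_def by simp
  qed
  have orbit_V: "(f ^^ n) x \<in> V" for n
    using x fV by (induction n) auto
  have orbit_E: "(((f ^^ (m + k)) x, (f ^^ m) x), ((f ^^ k) x, x)) \<in> E" for m k
  proof (induction m)
    case 0
    show ?case using orbit_V x by (simp add: E_refl)
  next
    case (Suc m)
    then show ?case using E_trans[OF fE[OF orbit_V orbit_V]] by simp
  qed
  have orbit_S: "((f ^^ n) x, (f ^^ m) x) \<in> S" if "m < n" for m n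
  proof -
    define j where "j = n - Suc m"
    have n: "n = m + Suc j" using \<open>m < n\<close> by (simp add: j_def)
    have "(f ^^ Suc j) x \<in> f ` V" using imageI[OF orbit_V[of j], of f] by simp
    with orbit_E[of m "Suc j"] have "\<exists>y\<in>f ` V. (((f ^^ n) x, (f ^^ m) x), (y, x)) \<in> E"
      unfolding n by (rule bexI)
    then show ?thesis by (simp add: S_def)
  qed
  show "x \<in> f ` V"
  proof (rule ccontr)
    assume nx: "x \<notin> f ` V"
    define \<U> where "\<U> = {U. openin X U \<and> U \<times> U \<inter> S = {}}"
    have "p \<in> \<Union>\<U>" if p: "p \<in> V" for p
    proof -
      have "(p, p) \<notin> S"
      proof
        assume "(p, p) \<in> S"
        then obtain y where y: "y \<in> f ` V" "((p, p), (y, x)) \<in> E" unfolding S_def by auto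
        from E_diagonal[OF E_sym[OF y(2)]] y(1) nx show False by simp
      qed
      then have "(p, p) \<in> topspace ?P - S" using p by simp
      moreover have "openin ?P (topspace ?P - S)" using S_closed by blast
      ultimately have "\<exists>U U'. openin X U \<and> openin X U' \<and> p \<in> U \<and> p \<in> U' \<and> U \<times> U' \<subseteq> topspace ?P - S"
        by (simp only: openin_prod_topology_alt)
      then obtain U U' where U: "openin X U" "openin X U'" "p \<in> U" "p \<in> U'" "U \<times> U' \<subseteq> topspace ?P - S"
        by (elim exE conjE)
      then have "U \<inter> U' \<in> \<U>" unfolding \<U>_def by (auto intro: openin_Int)
      with U show ?thesis by (intro UnionI[of "U \<inter> U'"]) auto
    qed
    moreover have "openin X U" if "U \<in> \<U>" for U
      using that by (simp add: \<U>_def)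
    ultimately obtain \<F> where \<F>: "finite \<F>" "\<F> \<subseteq> \<U>" "V \<subseteq> \<Union>\<F>"
      using compactinD[of X V \<U>] compact_X unfolding compact_space_def by (meson subsetI)
    \<comment> \<open>Infinitely many exponents, finitely many sets: two iterates share a member of the cover.\<close>
    have "\<exists>U. U \<in> \<F> \<and> (f ^^ n) x \<in> U" for n
      using subsetD[OF \<F>(3) orbit_V[of n]] by (simp add: Bex_def)
    then obtain c where c: "\<And>n. c n \<in> \<F>" "\<And>n. (f ^^ n) x \<in> c n" by metis
    have "finite (range c)" using c(1) by (intro finite_subset[OF _ \<F>(1)]) auto
    then have "\<not> inj c" using finite_imageD by fastforce
    then obtain m n where mn: "m < n" "c m = c n"
      by (meson linorder_injI)
    have "((f ^^ n) x, (f ^^ m) x) \<in> c n \<times> c n" using c(2)[of n] c(2)[of m] mn(2) by simp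
    moreover have "c n \<times> c n \<inter> S = {}" using c(1)[of n] \<F>(2) by (auto simp: \<U>_def)
    ultimately show False using orbit_S[OF mn(1)] by (meson disjoint_iff)
  qed
qed

lemma morphism_automorphism: "morphism V E f \<Longrightarrow> automorphism V E f"
  using morphism_surj[of f] partial_morphism_inj_on[of V f]
  by (auto simp: automorphism_def morphism_def bij_betw_def partial_morphism_def)

section \<open>The automorphism group\<close>

text \<open>Surjectivity of morphisms makes \<open>Aut\<close> an instance of \<open>Mor\<close>, so that the compactness and the
  coordinatewise description of the topology carry over.\<close>

lemma Aut_eq_Mor: "Aut V E = Mor V E V"
  using morphism_automorphism by (auto simp: Aut_def Mor_def automorphism_def morphism_def)

lemma Aut_Bij: "g \<in> Aut V E \<Longrightarrow> g \<in> Bij V"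
  by (auto simp: Aut_def Bij_def automorphism_def)

lemma Aut_funcset: "g \<in> Aut V E \<Longrightarrow> g \<in> V \<rightarrow> V"
  by (simp add: Aut_Bij Bij_imp_funcset)

lemma Aut_E: "g \<in> Aut V E \<Longrightarrow> x \<in> V \<Longrightarrow> y \<in> V \<Longrightarrow> ((g x, g y), (x, y)) \<in> E"
  by (simp add: Aut_eq_Mor Mor_iff)

lemma AutI:
  "g \<in> extensional V \<Longrightarrow> g \<in> V \<rightarrow> V \<Longrightarrow> (\<And>x y. x \<in> V \<Longrightarrow> y \<in> V \<Longrightarrow> ((g x, g y), (x, y)) \<in> E)
    \<Longrightarrow> g \<in> Aut V E"
  by (simp add: Aut_eq_Mor Mor_iff PiE_def)

lemma compose_Aut: "g \<in> Aut V E \<Longrightarrow> h \<in> Aut V E \<Longrightarrow> compose V g h \<in> Aut V E"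
proof (rule AutI)
  assume g: "g \<in> Aut V E" and h: "h \<in> Aut V E"
  show "compose V g h \<in> V \<rightarrow> V" using Aut_funcset[OF g] Aut_funcset[OF h] by (auto simp: compose_def)
  show "((compose V g h x, compose V g h y), (x, y)) \<in> E" if "x \<in> V" "y \<in> V" for x y
  proof -
    have "h x \<in> V" "h y \<in> V" using that Aut_funcset[OF h] by auto
    then show ?thesis
      using that E_trans[OF Aut_E[OF g] Aut_E[OF h]] by (simp add: compose_def)
  qed
qed simp

lemma inv_into_Aut:
  assumes g: "g \<in> Aut V E"
  shows "restrict (inv_into V g) V \<in> Aut V E"
proof (rule AutI)
  have surj: "g ` V = V" using Aut_Bij[OF g] by (simp add: Bij_def bij_betw_def)
  then show "restrict (inv_into V g) V \<in> V \<rightarrow> V" by (simp add: inv_into_into)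
  show "((restrict (inv_into V g) V x, restrict (inv_into V g) V y), (x, y)) \<in> E"
    if "x \<in> V" "y \<in> V" for x y
    using that E_sym[OF Aut_E[OF g, of "inv_into V g x" "inv_into V g y"]] surj
    by (simp add: f_inv_into_f inv_into_into)
qed simp

lemma subgroup_Aut: "subgroup (Aut V E) (BijGroup V)"
proof
  show "Aut V E \<subseteq> carrier (BijGroup V)" using Aut_Bij by (auto simp: BijGroup_def)
  show "g \<otimes>\<^bsub>BijGroup V\<^esub> h \<in> Aut V E" if "g \<in> Aut V E" "h \<in> Aut V E" for g h
    using that Aut_Bij compose_Aut by (simp add: BijGroup_def)
  show "\<one>\<^bsub>BijGroup V\<^esub> \<in> Aut V E"
    by (auto simp: BijGroup_def E_refl intro!: AutI)
  show "inv\<^bsub>BijGroup V\<^esub> g \<in> Aut V E" if "g \<in> Aut V E" for g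
    using that by (simp add: inv_BijGroup Aut_Bij inv_into_Aut)
qed

lemma group_AutGroup: "group (AutGroup V E)"
  unfolding AutGroup_def using subgroup_Aut group_BijGroup by (rule subgroup.subgroup_is_group)

lemma mult_AutGroup: "g \<in> Aut V E \<Longrightarrow> h \<in> Aut V E \<Longrightarrow> g \<otimes>\<^bsub>AutGroup V E\<^esub> h = compose V g h"
  by (simp add: AutGroup_def BijGroup_def Aut_Bij)

lemma inv_AutGroup:
  assumes g: "g \<in> Aut V E"
  shows "inv\<^bsub>AutGroup V E\<^esub> g = restrict (inv_into V g) V"
proof (rule group.inv_equality[OF group_AutGroup])
  show "restrict (inv_into V g) V \<otimes>\<^bsub>AutGroup V E\<^esub> g = \<one>\<^bsub>AutGroup V E\<^esub>"
    using g by (simp add: mult_AutGroup inv_into_Aut Bij_compose_restrict_eq Aut_Bij)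
      (simp add: AutGroup_def BijGroup_def)
qed (use g inv_into_Aut in \<open>auto simp: AutGroup_def\<close>)

lemma topspace_pointwise_V: "topspace (pointwise V) = Aut V E"
  by (simp add: topspace_pointwise Aut_eq_Mor)

text \<open>Joint continuity of evaluation in the form used for the group operations: function and argument
  may both depend continuously on a parameter.\<close>

lemma continuous_map_apply:
  assumes "continuous_map T (pointwise V) F" "continuous_map T X s"
  shows "continuous_map T X (\<lambda>t. F t (s t))"
proof -
  have "continuous_map T (prod_topology (pointwise V) (subtopology X V)) (\<lambda>t. (F t, s t))"
    using assms by (simp add: continuous_map_paired)
  from continuous_map_compose[OF this joint_evaluation_continuous] show ?thesis
    by (simp add: o_def)
qed

lemma continuous_compose:
  "continuous_map (prod_topology (pointwise V) (pointwise V)) (pointwise V)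
     (\<lambda>(g, h). g \<otimes>\<^bsub>AutGroup V E\<^esub> h)"
proof (rule continuous_map_into_pointwise)
  show "(\<lambda>(g, h). g \<otimes>\<^bsub>AutGroup V E\<^esub> h) \<in> topspace (prod_topology (pointwise V) (pointwise V)) \<rightarrow> Mor V E V"
    using compose_Aut by (auto simp: topspace_pointwise_V mult_AutGroup simp flip: Aut_eq_Mor)
next
  fix a assume a: "a \<in> V"
  have "continuous_map (prod_topology (pointwise V) (pointwise V)) X (\<lambda>p. fst p (snd p a))"
    by (rule continuous_map_apply[OF continuous_map_fst continuous_map_pointwise_eval[OF continuous_map_snd a]])
  then show "continuous_map (prod_topology (pointwise V) (pointwise V)) X
      (\<lambda>p. (case p of (g, h) \<Rightarrow> g \<otimes>\<^bsub>AutGroup V E\<^esub> h) a)"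
    by (rule continuous_map_eq) (use a in \<open>auto simp: topspace_pointwise_V mult_AutGroup compose_def\<close>)
qed

text \<open>Each coordinate \<open>g \<mapsto> g\<^sup>-\<^sup>1 a\<close> has the graph \<open>{(g, y). g y = a}\<close>, the preimage of a point under the
  continuous evaluation map.\<close>

lemma continuous_inverse:
  "continuous_map (pointwise V) (pointwise V) (\<lambda>g. inv\<^bsub>AutGroup V E\<^esub> g)"
proof (rule continuous_map_into_pointwise)
  show "(\<lambda>g. inv\<^bsub>AutGroup V E\<^esub> g) \<in> topspace (pointwise V) \<rightarrow> Mor V E V"
    using inv_into_Aut by (auto simp: topspace_pointwise_V inv_AutGroup simp flip: Aut_eq_Mor)
next
  fix a assume a: "a \<in> V"
  let ?i = "\<lambda>g. (inv\<^bsub>AutGroup V E\<^esub> g) a"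
  have i: "y = ?i g \<longleftrightarrow> g y = a" if "g \<in> Aut V E" "y \<in> V" for g y
  proof -
    have "bij_betw g V V" using that Aut_Bij by (auto simp: Bij_def)
    then show ?thesis
      using that a by (auto simp: inv_AutGroup bij_betw_def inv_into_f_f f_inv_into_f)
  qed
  have iV: "?i g \<in> V" if "g \<in> Aut V E" for g
    using Aut_funcset[OF inv_into_Aut[OF that]] a that by (simp add: inv_AutGroup Pi_iff)
  have "(\<lambda>g. (g, ?i g)) ` topspace (pointwise V) =
      {w \<in> topspace (prod_topology (pointwise V) X). fst w (snd w) \<in> {a}}" (is "?G = ?R")
  proof
    have "g (?i g) = a" if "g \<in> Aut V E" for g
      using i[OF that iV[OF that]] by simp
    then show "?G \<subseteq> ?R" using iV by (simp add: topspace_pointwise_V image_subset_iff)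
    show "?R \<subseteq> ?G"
    proof
      fix w assume "w \<in> ?R"
      then have w: "fst w \<in> Aut V E" "snd w \<in> V" "fst w (snd w) = a"
        by (auto simp: topspace_pointwise_V)
      then have "snd w = ?i (fst w)" by (simp only: i)
      then have "w = (fst w, ?i (fst w))" by (metis prod.collapse)
      then show "w \<in> ?G" using w(1) unfolding topspace_pointwise_V by (rule image_eqI)
    qed
  qed
  moreover have "closedin (prod_topology (pointwise V) X) ?R"
  proof (rule closedin_continuous_map_preimage)
    show "continuous_map (prod_topology (pointwise V) X) X (\<lambda>w. fst w (snd w))"
      by (rule continuous_map_apply[OF continuous_map_fst continuous_map_snd])
    show "closedin X {a}" using a Hausdorff_X by (simp add: closedin_Hausdorff_sing_eq)
  qed
  ultimately have "closedin (prod_topology (pointwise V) X) ?G" by (simp only:)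
  moreover have "?i \<in> topspace (pointwise V) \<rightarrow> V" using iV by (simp add: topspace_pointwise_V)
  ultimately show "continuous_map (pointwise V) X ?i"
    by (intro continuous_map_if_closed_graph[OF compact_X])
qed

lemma Aut_topology_eq_pointwise:
  "subtopology (compact_open_topology X X) (Aut V E) = pointwise V"
  using compact_open_eq_pointwise[of V] by (simp add: Aut_eq_Mor)

lemma topological_group_Aut: "topological_group (AutGroup V E) (pointwise V)"
  unfolding topological_group_def
  using group_AutGroup continuous_compose continuous_inverse
  by (simp add: topspace_pointwise_V AutGroup_def)

section \<open>Absolute homogeneity\<close>

lemma partial_morphism_subset:
  "partial_morphism V E A f \<Longrightarrow> B \<subseteq> A \<Longrightarrow> partial_morphism V E B f"
  unfolding partial_morphism_def by (meson Pi_anti_mono subset_iff subset_trans)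

definition one_point_extendable where
  "one_point_extendable D \<longleftrightarrow> (\<forall>A f. finite A \<and> partial_morphism V E A f \<longrightarrow>
     (\<forall>a\<in>D. \<exists>g. partial_morphism V E (insert a A) g \<and> (\<forall>x\<in>A. g x = f x)))"

lemma one_point_extendableD:
  assumes "one_point_extendable D" "finite A" "partial_morphism V E A f" "a \<in> D"
  shows "\<exists>g. partial_morphism V E (insert a A) g \<and> (\<forall>x\<in>A. g x = f x)"
  by (rule assms(1)[unfolded one_point_extendable_def, THEN spec, THEN spec, THEN mp, THEN bspec,
        OF conjI, OF assms(2-4)])

lemma partial_morphism_extends_finitely:
  assumes ext: "one_point_extendable D"
    and "finite F" "F \<subseteq> D" "finite A" "partial_morphism V E A f"
  shows "\<exists>g. partial_morphism V E (A \<union> F) g \<and> (\<forall>x\<in>A. g x = f x)"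
  using \<open>finite F\<close> \<open>F \<subseteq> D\<close>
proof (induction F)
  case empty
  show ?case using \<open>partial_morphism V E A f\<close> by (intro exI[of _ f]) simp
next
  case (insert a F)
  then obtain g where g: "partial_morphism V E (A \<union> F) g" "\<forall>x\<in>A. g x = f x" by auto
  have "finite (A \<union> F)" "a \<in> D" using insert \<open>finite A\<close> by auto
  from one_point_extendableD[OF ext this(1) g(1) this(2)] obtain h where "partial_morphism V E (insert a (A \<union> F)) h" "\<forall>x\<in>A \<union> F. h x = g x"
    by (elim exE conjE)
  then show ?case using g(2) by (intro exI[of _ h]) simp
qed

text \<open>Maps that agree with \<open>f\<close> on \<open>A \<inter> F\<close> and are partial morphisms on \<open>F\<close>, for finite \<open>F \<subseteq> A \<union> D\<close>, form
  closed sets \<open>C F\<close> in the compact power of \<open>X\<close>. They are nonempty because \<open>f\<close> restricted to \<open>A \<inter> F\<close>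
  extends point by point to \<open>F\<close>, and downward directed because \<open>C\<close> is antitone. A common point is
  the required extension.\<close>

lemma partial_morphism_extends_to_union:
  assumes ext: "one_point_extendable D"
    and D: "D \<subseteq> V" and f: "partial_morphism V E A f"
  obtains g where "partial_morphism V E (A \<union> D) g" "\<forall>x\<in>A. g x = f x"
proof -
  let ?P = "product_topology (\<lambda>_. X) V"
  have A: "A \<subseteq> V" and fV: "f \<in> A \<rightarrow> V" using f by (auto simp: partial_morphism_def)
  define C where "C F = {g \<in> topspace ?P. \<forall>x\<in>F. \<forall>y\<in>F. ((g x, g y), (x, y)) \<in> E}
      \<inter> {g \<in> topspace ?P. \<forall>x\<in>A \<inter> F. g x \<in> {f x}}" for F
  have C_closed: "closedin ?P (C F)" if "F \<subseteq> A \<union> D" for F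
    unfolding C_def
  proof (intro closedin_Int closedin_partial_morphism closedin_Collect_ball closedin_continuous_map_preimage[of _ X])
    show "F \<subseteq> V" using that A D by auto
    show "closedin X {f x}" if "x \<in> A \<inter> F" for x
      using that fV Hausdorff_X by (auto simp: closedin_Hausdorff_sing_eq)
  qed (use A in \<open>auto intro: continuous_map_product_projection\<close>)
  have C_nonempty: "C F \<noteq> {}" if F: "finite F" "F \<subseteq> A \<union> D" for F
  proof -
    obtain g where g: "partial_morphism V E (A \<inter> F \<union> (F \<inter> D)) g" "\<forall>x\<in>A \<inter> F. g x = f x"
      using partial_morphism_extends_finitely[OF ext _ Int_lower2 _ partial_morphism_subset[OF f Int_lower1]]
        F(1) by (meson finite_Int)
    have "A \<inter> F \<union> (F \<inter> D) = F" using F by auto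
    with g(1) have gF: "partial_morphism V E F g" by simp
    then have FV: "F \<subseteq> V" and gV: "\<And>x. x \<in> F \<Longrightarrow> g x \<in> V"
      and gE: "\<And>x y. x \<in> F \<Longrightarrow> y \<in> F \<Longrightarrow> ((g x, g y), (x, y)) \<in> E"
      by (auto simp: partial_morphism_def)
    \<comment> \<open>Values off \<open>F\<close> are unconstrained; the identity merely keeps them inside \<open>V\<close>.\<close>
    define h where "h = (\<lambda>x\<in>V. if x \<in> F then g x else x)"
    have hg: "h x = g x" if "x \<in> F" for x using that FV by (auto simp: h_def)
    have "h \<in> topspace ?P" using gV by (simp add: h_def)
    then have "h \<in> C F" unfolding C_def using gE g(2) by (simp add: hg)
    then show ?thesis by (rule ex_in_conv[THEN iffD1, OF exI])
  qed
  have "\<Inter>(C ` {F. finite F \<and> F \<subseteq> A \<union> D}) \<noteq> {}"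
  proof (rule compact_product[unfolded compact_space_fip, rule_format], intro conjI ballI allI impI)
    show "closedin ?P K" if "K \<in> C ` {F. finite F \<and> F \<subseteq> A \<union> D}" for K
      using that C_closed by auto
  next
    fix \<F> assume "finite \<F> \<and> \<F> \<subseteq> C ` {F. finite F \<and> F \<subseteq> A \<union> D}"
    then obtain \<G> where \<G>: "finite \<G>" "\<G> \<subseteq> {F. finite F \<and> F \<subseteq> A \<union> D}" "\<F> = C ` \<G>"
      by (meson finite_subset_image)
    have "C (\<Union>\<G>) \<subseteq> \<Inter>\<F>" unfolding \<G>(3) by (auto simp: C_def)
    moreover have "C (\<Union>\<G>) \<noteq> {}" using \<G> by (intro C_nonempty) auto
    ultimately show "\<Inter>\<F> \<noteq> {}" by (metis subset_empty)
  qed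
  then obtain g where "g \<in> \<Inter>(C ` {F. finite F \<and> F \<subseteq> A \<union> D})"
    unfolding ex_in_conv[symmetric] ..
  then have g: "g \<in> C F" if "finite F" "F \<subseteq> A \<union> D" for F
    using that by simp
  show thesis
  proof
    have "((g x, g y), (x, y)) \<in> E" if "x \<in> A \<union> D" "y \<in> A \<union> D" for x y
      using g[of "{x, y}"] that by (auto simp: C_def)
    moreover have "g x \<in> V" if "x \<in> A \<union> D" for x
      using g[of "{}"] that A D by (auto simp: C_def)
    ultimately show "partial_morphism V E (A \<union> D) g"
      unfolding partial_morphism_def using A D by (intro conjI ballI Pi_I Un_least)
    show "\<forall>x\<in>A. g x = f x"
    proof
      fix x assume "x \<in> A"
      then show "g x = f x" using g[of "{x}"] by (auto simp: C_def)
    qed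
  qed
qed

text \<open>Only the reverse implication has content. The closed domain produced by \<open>partial_morphism_extends_to_closed_set\<close> contains the dense set \<open>D\<close>,
  so it is the whole space, and the extension is a morphism, hence an automorphism.\<close>

lemma absolutely_homogeneous_iff:
  assumes D: "D \<subseteq> V" "X closure_of D = V"
  shows "absolutely_homogeneous V E \<longleftrightarrow> one_point_extendable D"
proof
  assume hom: "absolutely_homogeneous V E"
  show "one_point_extendable D"
    unfolding one_point_extendable_def
  proof (intro allI impI ballI, elim conjE)
    fix A f a assume f: "partial_morphism V E A f" and a: "a \<in> D"
    obtain g where g: "automorphism V E g" "\<forall>x\<in>A. g x = f x"
      using hom f unfolding absolutely_homogeneous_def by meson
    have "partial_morphism V E (insert a A) g"
    proof (rule partial_morphism_subset)
      show "partial_morphism V E V g" using g(1) by (simp add: automorphism_def morphism_def)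
      show "insert a A \<subseteq> V" using f a D(1) by (auto simp: partial_morphism_def)
    qed
    with g(2) show "\<exists>g. partial_morphism V E (insert a A) g \<and> (\<forall>x\<in>A. g x = f x)"
      by (intro exI conjI)
  qed
next
  assume ext: "one_point_extendable D"
  show "absolutely_homogeneous V E"
    unfolding absolutely_homogeneous_def
  proof (intro allI impI)
    fix A f assume f: "partial_morphism V E A f"
    obtain g where g: "partial_morphism V E (A \<union> D) g" "\<forall>x\<in>A. g x = f x"
      by (rule partial_morphism_extends_to_union[OF ext D(1) f])
    obtain B h where h: "closedin X B" "A \<union> D \<subseteq> B" "partial_morphism V E B h" "\<forall>x\<in>A \<union> D. h x = g x"
      by (rule partial_morphism_extends_to_closed_set[OF g(1)])
    have "B = V"
      using closure_of_minimal[of D B X] h(1,2) D(2) closedin_subset[OF h(1)] by simp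
    then have "automorphism V E h"
      using h(3) by (simp add: morphism_automorphism morphism_def)
    moreover have "\<forall>x\<in>A. h x = f x" using g(2) h(4) by auto
    ultimately show "\<exists>g. automorphism V E g \<and> (\<forall>x\<in>A. g x = f x)"
      by (intro exI conjI)
  qed
qed

end

theorem theorem8p8:
  fixes X :: "'a topology" and E :: "(('a \<times> 'a) \<times> ('a \<times> 'a)) set"
  assumes "cdGES X E"
  shows
    "(\<forall>A f. partial_morphism (topspace X) E A f \<longrightarrow>
       continuous_map (subtopology X A) X f \<and>
       (\<exists>B g. closedin X B \<and> A \<subseteq> B \<and> partial_morphism (topspace X) E B g \<and>
              (\<forall>x\<in>A. g x = f x))) \<and>
     (\<forall>Z. closedin X Z \<longrightarrow>
       compactin (compact_open_topology (subtopology X Z) X) (Mor (topspace X) E Z)) \<and>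
     (\<forall>f. morphism (topspace X) E f \<longrightarrow> automorphism (topspace X) E f) \<and>
     (let T = subtopology (compact_open_topology X X) (Aut (topspace X) E) in
       topological_group (AutGroup (topspace X) E) T \<and> compact_space T \<and> Hausdorff_space T) \<and>
     (\<forall>D. D \<subseteq> topspace X \<and> X closure_of D = topspace X \<longrightarrow>
       (absolutely_homogeneous (topspace X) E \<longleftrightarrow>
        (\<forall>A f. finite A \<and> partial_morphism (topspace X) E A f \<longrightarrow>
           (\<forall>a\<in>D. \<exists>g. partial_morphism (topspace X) E (insert a A) g \<and>
                         (\<forall>x\<in>A. g x = f x)))))"
proof -
  interpret compact_dGES X E using assms by unfold_locales
  show ?thesis
    unfolding Let_def Aut_topology_eq_pointwise one_point_extendable_def[symmetric]
  proof (intro conjI allI impI; (elim conjE)?)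
    fix A f assume f: "partial_morphism (topspace X) E A f"
    show "continuous_map (subtopology X A) X f" by (rule partial_morphism_continuous[OF f])
    obtain B g where "closedin X B" "A \<subseteq> B" "partial_morphism (topspace X) E B g" "\<forall>x\<in>A. g x = f x"
      by (rule partial_morphism_extends_to_closed_set[OF f])
    then show "\<exists>B g. closedin X B \<and> A \<subseteq> B \<and> partial_morphism (topspace X) E B g \<and> (\<forall>x\<in>A. g x = f x)"
      by (intro exI conjI)
  next
    show "compactin (compact_open_topology (subtopology X Z) X) (Mor (topspace X) E Z)"
      if "closedin X Z" for Z
      by (rule compactin_Mor[OF closedin_subset[OF that]])
    show "automorphism (topspace X) E f" if "morphism (topspace X) E f" for f
      by (rule morphism_automorphism[OF that])
    show "topological_group (AutGroup (topspace X) E) (pointwise (topspace X))"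
      by (rule topological_group_Aut)
    show "compact_space (pointwise (topspace X))" by (rule compact_pointwise[OF order_refl])
    show "Hausdorff_space (pointwise (topspace X))" by (rule Hausdorff_pointwise)
    show "absolutely_homogeneous (topspace X) E \<longleftrightarrow> one_point_extendable D"
      if "D \<subseteq> topspace X" "X closure_of D = topspace X" for D
      by (rule absolutely_homogeneous_iff[OF that])
  qed
qed

end
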